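(* Let $\mathcal{Y}_1,\mathcal{Y}_2,\mathcal{X}$ be Polish spaces, $\mathcal{S}=\mathcal{Y}_1\times\mathcal{Y}_2\times\mathcal{X}$ and $\mathcal{S}_\ell=\mathcal{Y}_\ell\times\mathcal{X}$ for $\ell=1,2$. For $\ell=1,2$ let $\boldsymbol{d}_{\mathcal{S}_\ell}$ be a metric making $\mathcal{S}_\ell$ (with its product topology) a Polish metric space, let $p_\ell\ge1$, $c_\ell(s_\ell,s_\ell')=\boldsymbol{d}_{\mathcal{S}_\ell}(s_\ell,s_\ell')^{p_\ell}$, and let $\mu_{\ell3}\in\mathcal{P}_{p_\ell}(\mathcal{S}_\ell)$, where $\mu_{13}$ and $\mu_{23}$ have the same projection on $\mathcal{X}$. Let $f:\mathcal{S}\to\mathbb{R}$ be measurable with $\int_{\mathcal{S}} f\,d\nu_0>-\infty$ for some $\nu_0\in\mathcal{F}(\mu_{13},\mu_{23})$. Then for all $\delta\in\mathbb{R}_{++}^2$, $\mathcal{I}(\delta)<\infty$ if and only if there exist $(s_1^\star,s_2^\star)\in\mathcal{S}_1\times\mathcal{S}_2$, with $s_\ell^\star=(y_\ell^\star,x^\star)$ for $\ell=1,2$, and a constant $M>0$ such that $$f(s)\le M\left[1+\boldsymbol{d}_{\mathcal{S}_1}(s_1^\star,s_1)^{p_1}+\boldsymbol{d}_{\mathcal{S}_2}(s_2^\star,s_2)^{p_2}\right]$$ for all $s=(y_1,y_2,x)\in\mathcal{S}$, where $s_\ell=(y_\ell,x)$ for $\ell=1,2$.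
   Context: $\mathcal{P}(\cdot)$ is the set of Borel probability measures; $\mathcal{P}_p(\mathcal{X})$ is the set of $\mu\in\mathcal{P}(\mathcal{X})$ with $\int\boldsymbol{d}(x_0,x)^p\,d\mu(x)<\infty$ for some (any) $x_0$; $\Pi(\mu,\nu)$ is the set of couplings; $\mathbb{R}_{++}^2$ is the set of vectors with strictly positive coordinates. For $\gamma\in\mathcal{P}(\mathcal{S})$, $\gamma_{\ell3}$ is its projection on $\mathcal{Y}_\ell\times\mathcal{X}$; $\mathcal{F}(\mu_{13},\mu_{23})=\{\gamma\in\mathcal{P}(\mathcal{S}):\gamma_{13}=\mu_{13},\gamma_{23}=\mu_{23}\}$. $\boldsymbol{K}_\ell(\mu,\nu)=\inf_{\pi\in\Pi(\mu,\nu)}\int c_\ell\,d\pi$; $\Sigma(\delta)=\{\gamma\in\mathcal{P}(\mathcal{S}):\boldsymbol{K}_1(\mu_{13},\gamma_{13})\le\delta_1,\ \boldsymbol{K}_2(\mu_{23},\gamma_{23})\le\delta_2\}$; $\mathcal{I}(\delta)=\sup_{\gamma\in\Sigma(\delta)}\int_{\mathcal{S}} f\,d\gamma$, the supremum being over those $\gamma$ for which the integral is well defined in $[-\infty,\infty]$. *)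

theory Defs
  imports "HOL-Probability.Probability"
begin

text \<open>The metric \<open>d\<close> is an arbitrary complete metric inducing the topology of the type, not
  necessarily the metric \<open>dist\<close> of a type class. Separability is part of the sort.\<close>

definition polish_metric :: "('s::second_countable_topology \<Rightarrow> 's \<Rightarrow> real) \<Rightarrow> bool" where
  "polish_metric d \<longleftrightarrow>
     Metric_space UNIV d \<and> Metric_space.mtopology UNIV d = euclidean \<and> Metric_space.mcomplete UNIV d"

definition borel_probs :: "'s::topological_space measure set" where
  "borel_probs = {\<mu>. prob_space \<mu> \<and> sets \<mu> = sets borel}"

definition borel_probs_moment ::
    "('s::topological_space \<Rightarrow> 's \<Rightarrow> real) \<Rightarrow> real \<Rightarrow> 's measure set" where
  "borel_probs_moment d p =
     {\<mu> \<in> borel_probs. \<exists>x0. (\<integral>\<^sup>+x. ennreal (d x0 x powr p) \<partial>\<mu>) < \<infinity>}"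

definition couplings ::
    "'s::topological_space measure \<Rightarrow> 't::topological_space measure \<Rightarrow> ('s \<times> 't) measure set" where
  "couplings \<mu> \<nu> = {\<pi> \<in> borel_probs. distr \<pi> borel fst = \<mu> \<and> distr \<pi> borel snd = \<nu>}"

definition transport_cost ::
    "('s::topological_space \<Rightarrow> 's \<Rightarrow> real) \<Rightarrow> 's measure \<Rightarrow> 's measure \<Rightarrow> ennreal" where
  "transport_cost c \<mu> \<nu> = (INF \<pi> \<in> couplings \<mu> \<nu>. \<integral>\<^sup>+z. ennreal (c (fst z) (snd z)) \<partial>\<pi>)"

definition proj13 :: "'y1 \<times> 'y2 \<times> 'x \<Rightarrow> 'y1 \<times> 'x" where
  "proj13 = (\<lambda>(y1, y2, x). (y1, x))"

definition proj23 :: "'y1 \<times> 'y2 \<times> 'x \<Rightarrow> 'y2 \<times> 'x" where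
  "proj23 = (\<lambda>(y1, y2, x). (y2, x))"

definition marginal13 ::
    "('y1::topological_space \<times> 'y2::topological_space \<times> 'x::topological_space) measure
      \<Rightarrow> ('y1 \<times> 'x) measure" where
  "marginal13 \<gamma> = distr \<gamma> borel proj13"

definition marginal23 ::
    "('y1::topological_space \<times> 'y2::topological_space \<times> 'x::topological_space) measure
      \<Rightarrow> ('y2 \<times> 'x) measure" where
  "marginal23 \<gamma> = distr \<gamma> borel proj23"

definition overlapping_fiber ::
    "('y1::topological_space \<times> 'x::topological_space) measure
      \<Rightarrow> ('y2::topological_space \<times> 'x) measure \<Rightarrow> ('y1 \<times> 'y2 \<times> 'x) measure set" where
  "overlapping_fiber \<mu>13 \<mu>23 =
     {\<gamma> \<in> borel_probs. marginal13 \<gamma> = \<mu>13 \<and> marginal23 \<gamma> = \<mu>23}"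

definition ambiguity_set ::
    "('y1::topological_space \<times> 'x::topological_space \<Rightarrow> 'y1 \<times> 'x \<Rightarrow> real)
      \<Rightarrow> ('y2::topological_space \<times> 'x \<Rightarrow> 'y2 \<times> 'x \<Rightarrow> real)
      \<Rightarrow> ('y1 \<times> 'x) measure \<Rightarrow> ('y2 \<times> 'x) measure
      \<Rightarrow> real ^ 2 \<Rightarrow> ('y1 \<times> 'y2 \<times> 'x) measure set" where
  "ambiguity_set c1 c2 \<mu>13 \<mu>23 \<delta> =
     {\<gamma> \<in> borel_probs.
        transport_cost c1 \<mu>13 (marginal13 \<gamma>) \<le> ennreal (\<delta> $ 1) \<and>
        transport_cost c2 \<mu>23 (marginal23 \<gamma>) \<le> ennreal (\<delta> $ 2)}"

text \<open>The integral with values in \<open>[-\<infinity>, \<infinity>]\<close>. It is meaningful only when the positive and negative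
  parts do not both have infinite integral; \<open>ext_integral\<close> is always used under that guard.\<close>

definition integral_well_defined :: "'s measure \<Rightarrow> ('s \<Rightarrow> real) \<Rightarrow> bool" where
  "integral_well_defined \<gamma> f \<longleftrightarrow>
     (\<integral>\<^sup>+s. ennreal (f s) \<partial>\<gamma>) < \<infinity> \<or> (\<integral>\<^sup>+s. ennreal (- f s) \<partial>\<gamma>) < \<infinity>"

definition ext_integral :: "'s measure \<Rightarrow> ('s \<Rightarrow> real) \<Rightarrow> ereal" where
  "ext_integral \<gamma> f =
     enn2ereal (\<integral>\<^sup>+s. ennreal (f s) \<partial>\<gamma>) - enn2ereal (\<integral>\<^sup>+s. ennreal (- f s) \<partial>\<gamma>)"

definition robust_value ::
    "('y1::topological_space \<times> 'x::topological_space \<Rightarrow> 'y1 \<times> 'x \<Rightarrow> real)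
      \<Rightarrow> ('y2::topological_space \<times> 'x \<Rightarrow> 'y2 \<times> 'x \<Rightarrow> real)
      \<Rightarrow> ('y1 \<times> 'x) measure \<Rightarrow> ('y2 \<times> 'x) measure
      \<Rightarrow> ('y1 \<times> 'y2 \<times> 'x \<Rightarrow> real) \<Rightarrow> real ^ 2 \<Rightarrow> ereal" where
  "robust_value c1 c2 \<mu>13 \<mu>23 f \<delta> =
     (SUP \<gamma> \<in> {\<gamma> \<in> ambiguity_set c1 c2 \<mu>13 \<mu>23 \<delta>. integral_well_defined \<gamma> f}. ext_integral \<gamma> f)"

end

theory Submission
  imports Defs
begin

text \<open>If \<open>f\<close> has the stated growth, its integral over any \<open>\<gamma>\<close> in the ambiguity set is controlled by the
  moments of the marginals of \<open>\<gamma>\<close>, and these are bounded through the moments of the reference marginals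
  and the transport budget. Conversely, for a point \<open>s\<close> move a fraction \<open>t\<close> of the mass of \<open>\<nu>\<^sub>0\<close> to \<open>s\<close>. With
  \<open>D\<close> the sum of the two transport costs from the base point to \<open>s\<close>, the choice \<open>t = \<epsilon> / (1 + D)\<close> respects
  both budgets for a fixed \<open>\<epsilon>\<close>, while the integral of \<open>f\<close> is at least \<open>t * f s\<close> minus a constant; hence
  \<open>f s\<close> is at most a constant times \<open>1 + D\<close>.\<close>

section \<open>Measurability and power estimates for metrics\<close>

text \<open>A metric is jointly continuous for the topology that it induces, and here that is the
  topology of the type.\<close>

lemma polish_metric_measurable:
  fixes d :: "'s::second_countable_topology \<Rightarrow> 's \<Rightarrow> real"
  assumes "polish_metric d"
  shows "(\<lambda>z. d (fst z) (snd z)) \<in> borel_measurable borel"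
proof -
  interpret Metric_space UNIV d using assms by (simp add: polish_metric_def)
  have top: "mtopology = euclidean"
    using assms by (simp add: polish_metric_def)
  have "continuous_map euclidean euclidean
      (\<lambda>z. mdist (metric (UNIV, d)) (fst z) (snd z))"
    by (rule continuous_map_mdist) (simp_all add: top continuous_on_fst continuous_on_snd)
  then show ?thesis
    by (intro borel_measurable_continuous_onI) simp
qed

text \<open>Second countability enters here: it makes a pair of Borel functions Borel measurable
  into the product space.\<close>

lemma polish_metric_measurable_comp [measurable (raw)]:
  fixes d :: "'s::second_countable_topology \<Rightarrow> 's \<Rightarrow> real"
  assumes "polish_metric d" "g \<in> borel_measurable M" "h \<in> borel_measurable M"
  shows "(\<lambda>z. d (g z) (h z)) \<in> borel_measurable M"
  using measurable_compose[OF borel_measurable_Pair[OF assms(2,3)] polish_metric_measurable[OF assms(1)]]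
  by simp

text \<open>The sum is at most twice the maximum, and the power of the maximum is one of the two
  summands. The constant is not sharp; it only ever serves as a finite factor.\<close>

lemma powr_add_le:
  fixes a b p :: real
  assumes "a \<ge> 0" "b \<ge> 0" "p \<ge> 0"
  shows "(a + b) powr p \<le> 2 powr p * (a powr p + b powr p)"
proof -
  have "(a + b) powr p \<le> (2 * max a b) powr p"
    using assms by (intro powr_mono2) auto
  also have "\<dots> = 2 powr p * max a b powr p"
    using assms by (simp add: powr_mult)
  also have "\<dots> \<le> 2 powr p * (a powr p + b powr p)"
    by (intro mult_left_mono) (auto simp: max_def)
  finally show ?thesis .
qed

lemma metric_powr_triangle:
  assumes "Metric_space UNIV d" and "p \<ge> 0"
  shows "d x z powr p \<le> 2 powr p * (d x y powr p + d y z powr p)"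
proof -
  interpret Metric_space UNIV d by fact
  have "d x z powr p \<le> (d x y + d y z) powr p"
    using assms(2) by (intro powr_mono2) (auto simp: triangle)
  also have "\<dots> \<le> 2 powr p * (d x y powr p + d y z powr p)"
    using assms(2) by (intro powr_add_le) auto
  finally show ?thesis .
qed

lemma ennreal_metric_powr_triangle:
  assumes "Metric_space UNIV d" and "p \<ge> 0"
  shows "ennreal (d x z powr p) \<le> ennreal (2 powr p) * (ennreal (d x y powr p) + ennreal (d y z powr p))"
proof -
  have "ennreal (d x z powr p) \<le> ennreal (2 powr p * (d x y powr p + d y z powr p))"
    by (intro ennreal_leI metric_powr_triangle assms)
  then show ?thesis by (simp add: ennreal_mult ennreal_plus)
qed

section \<open>Moments and transport costs\<close>

text \<open>Passing from the base point \<open>x0\<close> of the definition to \<open>a\<close>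
  costs a factor and the constant \<open>d a x0 powr p\<close>, whose integral is finite because the
  total mass is one.\<close>

lemma borel_probs_moment_finite:
  assumes d: "polish_metric d" and p: "p \<ge> 0" and \<mu>: "\<mu> \<in> borel_probs_moment d p"
  shows "(\<integral>\<^sup>+x. ennreal (d a x powr p) \<partial>\<mu>) < \<infinity>"
proof -
  from \<mu> obtain x0 where pr: "prob_space \<mu>" and sets [measurable_cong]: "sets \<mu> = sets borel"
    and fin: "(\<integral>\<^sup>+x. ennreal (d x0 x powr p) \<partial>\<mu>) < \<infinity>"
    by (auto simp: borel_probs_moment_def borel_probs_def)
  interpret prob_space \<mu> by fact
  note d [measurable]
  have "Metric_space UNIV d" using d by (simp add: polish_metric_def)
  then have "(\<integral>\<^sup>+x. ennreal (d a x powr p) \<partial>\<mu>)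
      \<le> (\<integral>\<^sup>+x. ennreal (2 powr p) * (ennreal (d a x0 powr p) + ennreal (d x0 x powr p)) \<partial>\<mu>)"
    by (intro nn_integral_mono ennreal_metric_powr_triangle p)
  also have "\<dots> = ennreal (2 powr p) * (ennreal (d a x0 powr p) + (\<integral>\<^sup>+x. ennreal (d x0 x powr p) \<partial>\<mu>))"
    by (simp add: nn_integral_cmult nn_integral_add emeasure_space_1)
  also have "\<dots> < \<infinity>" using fin by (simp add: ennreal_mult_less_top)
  finally show ?thesis .
qed

text \<open>The strict inequality yields a coupling of cost below \<open>\<kappa>\<close>, so no
  optimal coupling has to exist. Along it, the distance from \<open>a\<close> to the second
  coordinate is split at the first one.\<close>

lemma moment_le_transport_cost:
  assumes d: "polish_metric d" and p: "p \<ge> 0"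
    and cost: "transport_cost (\<lambda>s s'. d s s' powr p) \<mu> \<nu> < \<kappa>"
  shows "(\<integral>\<^sup>+x. ennreal (d a x powr p) \<partial>\<nu>)
    \<le> ennreal (2 powr p) * ((\<integral>\<^sup>+x. ennreal (d a x powr p) \<partial>\<mu>) + \<kappa>)"
proof -
  from cost obtain \<pi> where \<pi>: "\<pi> \<in> couplings \<mu> \<nu>"
    and less: "(\<integral>\<^sup>+z. ennreal (d (fst z) (snd z) powr p) \<partial>\<pi>) < \<kappa>"
    by (auto simp: transport_cost_def INF_less_iff)
  have sets [measurable_cong]: "sets \<pi> = sets borel"
    and \<mu>: "\<mu> = distr \<pi> borel fst" and \<nu>: "\<nu> = distr \<pi> borel snd"
    using \<pi> by (auto simp: couplings_def borel_probs_def)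
  note d [measurable]
  have [measurable]: "fst \<in> borel_measurable \<pi>" "snd \<in> borel_measurable \<pi>"
    by (auto simp: measurable_cong_sets[OF sets refl] borel_measurable_continuous_onI continuous_on_fst continuous_on_snd)
  have "Metric_space UNIV d" using d by (simp add: polish_metric_def)
  then have "(\<integral>\<^sup>+z. ennreal (d a (snd z) powr p) \<partial>\<pi>)
      \<le> (\<integral>\<^sup>+z. ennreal (2 powr p) * (ennreal (d a (fst z) powr p) + ennreal (d (fst z) (snd z) powr p)) \<partial>\<pi>)"
    by (intro nn_integral_mono ennreal_metric_powr_triangle p)
  also have "\<dots> = ennreal (2 powr p) * ((\<integral>\<^sup>+z. ennreal (d a (fst z) powr p) \<partial>\<pi>)
      + (\<integral>\<^sup>+z. ennreal (d (fst z) (snd z) powr p) \<partial>\<pi>))"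
    by (simp add: nn_integral_cmult nn_integral_add)
  also have "\<dots> \<le> ennreal (2 powr p) * ((\<integral>\<^sup>+z. ennreal (d a (fst z) powr p) \<partial>\<pi>) + \<kappa>)"
    using less by (intro mult_left_mono add_mono) auto
  finally show ?thesis
    unfolding \<mu> \<nu> by (simp add: nn_integral_distr)
qed

section \<open>Moving a fraction of the mass to a point\<close>

text \<open>This is the mixture of \<open>\<nu>\<close> with weight \<open>1 - t\<close> and the
  Dirac mass at \<open>s\<close> with weight \<open>t\<close>. Realising it by a coin toss keeps the
  original point next to the moved one, which supplies an explicit coupling.\<close>

definition contaminate :: "'s::topological_space measure \<Rightarrow> real \<Rightarrow> 's \<Rightarrow> 's measure" where
  "contaminate \<nu> t s =
     distr (\<nu> \<Otimes>\<^sub>M measure_pmf (bernoulli_pmf t)) borel (\<lambda>z. if snd z then s else fst z)"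

context
  fixes \<nu> :: "'s::second_countable_topology measure" and t :: real
  assumes \<nu>: "\<nu> \<in> borel_probs" and t: "0 \<le> t" "t \<le> 1"
begin

lemma sets_\<nu> [measurable_cong]: "sets \<nu> = sets borel"
  using \<nu> by (simp add: borel_probs_def)

interpretation \<nu>: prob_space \<nu>
  using \<nu> by (simp add: borel_probs_def)

interpretation pair_prob_space \<nu> "measure_pmf (bernoulli_pmf t)" ..

lemma contaminate_in_borel_probs: "contaminate \<nu> t s \<in> borel_probs"
  unfolding contaminate_def borel_probs_def by (auto intro!: prob_space_distr)

text \<open>By Tonelli with the coin as inner variable, the inner integral is a weighted sum of two
  values.\<close>

lemma nn_integral_bernoulli_product:
  assumes [measurable]: "g \<in> borel_measurable (\<nu> \<Otimes>\<^sub>M measure_pmf (bernoulli_pmf t))"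
  shows "(\<integral>\<^sup>+z. g z \<partial>(\<nu> \<Otimes>\<^sub>M measure_pmf (bernoulli_pmf t)))
    = ennreal t * (\<integral>\<^sup>+x. g (x, True) \<partial>\<nu>) + ennreal (1 - t) * (\<integral>\<^sup>+x. g (x, False) \<partial>\<nu>)"
proof -
  have [measurable]: "(\<lambda>x. g (x, b)) \<in> borel_measurable \<nu>" for b
    by measurable
  have "(\<integral>\<^sup>+z. g z \<partial>(\<nu> \<Otimes>\<^sub>M measure_pmf (bernoulli_pmf t)))
      = (\<integral>\<^sup>+x. \<integral>\<^sup>+b. g (x, b) \<partial>measure_pmf (bernoulli_pmf t) \<partial>\<nu>)"
    by (rule measure_pmf.nn_integral_fst[symmetric]) fact
  also have "\<dots> = (\<integral>\<^sup>+x. ennreal t * g (x, True) + ennreal (1 - t) * g (x, False) \<partial>\<nu>)"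
    using t by (simp add: mult.commute)
  finally show ?thesis by (simp add: nn_integral_add nn_integral_cmult)
qed

lemma nn_integral_contaminate:
  assumes [measurable]: "g \<in> borel_measurable borel"
  shows "(\<integral>\<^sup>+z. g z \<partial>contaminate \<nu> t s) = ennreal t * g s + ennreal (1 - t) * (\<integral>\<^sup>+z. g z \<partial>\<nu>)"
  unfolding contaminate_def
  by (simp add: nn_integral_distr nn_integral_bernoulli_product \<nu>.emeasure_space_1)

text \<open>The original point and its contaminated version, both mapped by \<open>h\<close>, form a
  coupling that pays only when the coin shows \<open>True\<close>. The map \<open>h\<close> is there
  for the two projections, so that one contaminated measure serves both marginals.\<close>

lemma transport_cost_contaminate:
  fixes h :: "'s \<Rightarrow> 'r::second_countable_topology"
  assumes [measurable]: "h \<in> borel_measurable borel"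
    and c [measurable]: "(\<lambda>z. c (fst z) (snd z)) \<in> borel_measurable borel"
    and c0: "\<And>x. c x x = 0"
  shows "transport_cost c (distr \<nu> borel h) (distr (contaminate \<nu> t s) borel h)
    \<le> ennreal t * (\<integral>\<^sup>+z. ennreal (c (h z) (h s)) \<partial>\<nu>)"
proof -
  let ?P = "\<nu> \<Otimes>\<^sub>M measure_pmf (bernoulli_pmf t)"
  let ?k = "\<lambda>z. (h (fst z), h (if snd z then s else fst z))"
  define \<pi> where "\<pi> = distr ?P borel ?k"
  have k [measurable]: "?k \<in> borel_measurable ?P" by measurable
  have [measurable]: "(fst :: 'r \<times> 'r \<Rightarrow> 'r) \<in> borel_measurable borel"
    "(snd :: 'r \<times> 'r \<Rightarrow> 'r) \<in> borel_measurable borel"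
    by (auto intro!: borel_measurable_continuous_onI continuous_intros)
  \<comment> \<open>The inner distribution has target \<open>\<nu>\<close> rather than
    \<open>borel\<close>, the form in which the first marginal of a product is known.\<close>
  have "distr \<pi> borel fst = distr (distr ?P \<nu> fst) borel h"
    unfolding \<pi>_def by (simp add: distr_distr comp_def)
  also have "distr ?P \<nu> fst = \<nu>"
    by (rule measure_pmf.distr_pair_fst)
  finally have 1: "distr \<pi> borel fst = distr \<nu> borel h" .
  have 2: "distr \<pi> borel snd = distr (contaminate \<nu> t s) borel h"
    unfolding \<pi>_def contaminate_def by (simp add: distr_distr comp_def)
  have "\<pi> \<in> couplings (distr \<nu> borel h) (distr (contaminate \<nu> t s) borel h)"
    unfolding couplings_def borel_probs_def using 1 2
    by (auto simp: \<pi>_def intro!: prob_space_distr)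
  then have "transport_cost c (distr \<nu> borel h) (distr (contaminate \<nu> t s) borel h)
      \<le> (\<integral>\<^sup>+z. ennreal (c (fst z) (snd z)) \<partial>\<pi>)"
    unfolding transport_cost_def by (rule INF_lower)
  also have "\<dots> = (\<integral>\<^sup>+z. ennreal (c (fst (?k z)) (snd (?k z))) \<partial>?P)"
    unfolding \<pi>_def by (rule nn_integral_distr) measurable
  also have "\<dots> = ennreal t * (\<integral>\<^sup>+z. ennreal (c (h z) (h s)) \<partial>\<nu>)"
    using measurable_compose[OF k c]
    by (subst nn_integral_bernoulli_product) (auto simp: c0)
  finally show ?thesis .
qed

end

section \<open>Growth implies a finite value\<close>

lemma borel_measurable_proj13 [measurable]:
  "(proj13 :: 'y1::second_countable_topology \<times> 'y2::second_countable_topology \<times> 'x::second_countable_topology \<Rightarrow> _)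
    \<in> borel_measurable borel"
  unfolding proj13_def case_prod_beta by (intro borel_measurable_continuous_onI continuous_intros)

lemma borel_measurable_proj23 [measurable]:
  "(proj23 :: 'y1::second_countable_topology \<times> 'y2::second_countable_topology \<times> 'x::second_countable_topology \<Rightarrow> _)
    \<in> borel_measurable borel"
  unfolding proj23_def case_prod_beta by (intro borel_measurable_continuous_onI continuous_intros)

text \<open>Integrating the growth bound leaves two moments of the marginals of
  \<open>\<gamma>\<close>, which the budgets bound uniformly over the ambiguity set.\<close>

lemma robust_value_finite_if_growth:
  fixes d1 :: "'y1::polish_space \<times> 'x::polish_space \<Rightarrow> 'y1 \<times> 'x \<Rightarrow> real"
    and d2 :: "'y2::polish_space \<times> 'x \<Rightarrow> 'y2 \<times> 'x \<Rightarrow> real"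
  assumes d: "polish_metric d1" "polish_metric d2"
    and p: "p1 \<ge> 0" "p2 \<ge> 0"
    and \<mu>: "\<mu>13 \<in> borel_probs_moment d1 p1" "\<mu>23 \<in> borel_probs_moment d2 p2"
    and \<delta>: "\<And>i. \<delta> $ i \<ge> 0"
    and M: "M \<ge> 0"
    and growth: "\<And>s. f s \<le> M * (1 + d1 a1 (proj13 s) powr p1 + d2 a2 (proj23 s) powr p2)"
  shows "robust_value (\<lambda>s s'. d1 s s' powr p1) (\<lambda>s s'. d2 s s' powr p2) \<mu>13 \<mu>23 f \<delta> < \<infinity>"
proof -
  \<comment> \<open>The ambiguity set only gives cost at most \<open>\<delta> $ 1\<close>; adding 1
    produces the strict inequality that \<open>moment_le_transport_cost\<close> asks for.\<close>
  define B1 where "B1 = ennreal (2 powr p1)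
    * ((\<integral>\<^sup>+x. ennreal (d1 a1 x powr p1) \<partial>\<mu>13) + ennreal (\<delta> $ 1 + 1))"
  define B2 where "B2 = ennreal (2 powr p2)
    * ((\<integral>\<^sup>+x. ennreal (d2 a2 x powr p2) \<partial>\<mu>23) + ennreal (\<delta> $ 2 + 1))"
  define B where "B = ennreal M * (1 + B1 + B2)"
  have "B < \<infinity>"
    using borel_probs_moment_finite[OF d(1) p(1) \<mu>(1), of a1]
      borel_probs_moment_finite[OF d(2) p(2) \<mu>(2), of a2]
    by (simp add: B_def B1_def B2_def ennreal_mult_less_top)
  note d [measurable]
  have le: "ext_integral \<gamma> f \<le> enn2ereal B"
    if \<gamma>: "\<gamma> \<in> ambiguity_set (\<lambda>s s'. d1 s s' powr p1) (\<lambda>s s'. d2 s s' powr p2) \<mu>13 \<mu>23 \<delta>" for \<gamma>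
  proof -
    have pr: "prob_space \<gamma>" and sets [measurable_cong]: "sets \<gamma> = sets borel"
      using \<gamma> by (auto simp: ambiguity_set_def borel_probs_def)
    interpret prob_space \<gamma> by fact
    have [measurable]: "proj13 \<in> borel_measurable \<gamma>" "proj23 \<in> borel_measurable \<gamma>"
      by (simp_all add: measurable_cong_sets[OF sets refl])
    have cost1: "transport_cost (\<lambda>s s'. d1 s s' powr p1) \<mu>13 (marginal13 \<gamma>) < ennreal (\<delta> $ 1 + 1)"
      using \<gamma> \<delta>[of 1] by (auto simp: ambiguity_set_def ennreal_less_iff intro: le_less_trans)
    have cost2: "transport_cost (\<lambda>s s'. d2 s s' powr p2) \<mu>23 (marginal23 \<gamma>) < ennreal (\<delta> $ 2 + 1)"
      using \<gamma> \<delta>[of 2] by (auto simp: ambiguity_set_def ennreal_less_iff intro: le_less_trans)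
    have B1: "(\<integral>\<^sup>+s. ennreal (d1 a1 (proj13 s) powr p1) \<partial>\<gamma>) \<le> B1"
      using moment_le_transport_cost[OF d(1) p(1) cost1, of a1]
      by (simp add: B1_def marginal13_def nn_integral_distr)
    have B2: "(\<integral>\<^sup>+s. ennreal (d2 a2 (proj23 s) powr p2) \<partial>\<gamma>) \<le> B2"
      using moment_le_transport_cost[OF d(2) p(2) cost2, of a2]
      by (simp add: B2_def marginal23_def nn_integral_distr)
    have "(\<integral>\<^sup>+s. ennreal (f s) \<partial>\<gamma>) \<le> (\<integral>\<^sup>+s. ennreal M *
        (1 + ennreal (d1 a1 (proj13 s) powr p1) + ennreal (d2 a2 (proj23 s) powr p2)) \<partial>\<gamma>)"
    proof (rule nn_integral_mono)
      fix s
      have "ennreal (f s) \<le> ennreal (M * (1 + d1 a1 (proj13 s) powr p1 + d2 a2 (proj23 s) powr p2))"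
        by (intro ennreal_leI growth)
      then show "ennreal (f s) \<le> ennreal M *
          (1 + ennreal (d1 a1 (proj13 s) powr p1) + ennreal (d2 a2 (proj23 s) powr p2))"
        using M by (simp add: ennreal_mult ennreal_plus)
    qed
    also have "\<dots> = ennreal M * (1 + (\<integral>\<^sup>+s. ennreal (d1 a1 (proj13 s) powr p1) \<partial>\<gamma>)
        + (\<integral>\<^sup>+s. ennreal (d2 a2 (proj23 s) powr p2) \<partial>\<gamma>))"
      by (simp add: nn_integral_cmult nn_integral_add emeasure_space_1)
    also have "\<dots> \<le> B"
      unfolding B_def by (intro mult_left_mono add_mono B1 B2) auto
    finally have "enn2ereal (\<integral>\<^sup>+s. ennreal (f s) \<partial>\<gamma>) \<le> enn2ereal B"
      by (simp add: less_eq_ennreal.rep_eq)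
    \<comment> \<open>Subtracting the integral of the negative part can only lower the
      value.\<close>
    then show ?thesis
      unfolding ext_integral_def
      by (metis ereal_diff_le_self enn2ereal_nonneg order_trans)
  qed
  have "robust_value (\<lambda>s s'. d1 s s' powr p1) (\<lambda>s s'. d2 s s' powr p2) \<mu>13 \<mu>23 f \<delta> \<le> enn2ereal B"
    unfolding robust_value_def by (rule SUP_least) (auto intro: le)
  also have "\<dots> < \<infinity>"
    using \<open>B < \<infinity>\<close> by (cases B) auto
  finally show ?thesis .
qed

section \<open>A finite value implies growth\<close>

text \<open>The distance from a point to \<open>h s\<close> is split at the base point
  \<open>a\<close>: one part integrates to the moment \<open>A\<close>, the other is
  constant.\<close>

lemma transport_cost_contaminate_le:
  fixes h :: "'s::second_countable_topology \<Rightarrow> 'r::second_countable_topology"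
  assumes \<nu>: "\<nu> \<in> borel_probs" and t: "0 \<le> t" "t \<le> 1"
    and h: "h \<in> borel_measurable borel"
    and d: "polish_metric d" and p: "p \<ge> 0"
    and moment: "(\<integral>\<^sup>+x. ennreal (d a x powr p) \<partial>distr \<nu> borel h) = ennreal A" "A \<ge> 0"
  shows "transport_cost (\<lambda>s s'. d s s' powr p) (distr \<nu> borel h) (distr (contaminate \<nu> t s) borel h)
    \<le> ennreal (t * (2 powr p * (A + d a (h s) powr p)))"
proof -
  have pr: "prob_space \<nu>" and sets [measurable_cong]: "sets \<nu> = sets borel"
    using \<nu> by (auto simp: borel_probs_def)
  interpret prob_space \<nu> by fact
  interpret Metric_space UNIV d using d by (simp add: polish_metric_def)
  have [measurable]: "h \<in> borel_measurable \<nu>"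
    using h by (simp add: measurable_cong_sets[OF sets refl])
  note d [measurable] h [measurable] polish_metric_measurable[OF d, measurable]
  have "transport_cost (\<lambda>s s'. d s s' powr p) (distr \<nu> borel h) (distr (contaminate \<nu> t s) borel h)
      \<le> ennreal t * (\<integral>\<^sup>+z. ennreal (d (h z) (h s) powr p) \<partial>\<nu>)"
    by (rule transport_cost_contaminate[OF \<nu> t]) auto
  also have "(\<integral>\<^sup>+z. ennreal (d (h z) (h s) powr p) \<partial>\<nu>)
      \<le> (\<integral>\<^sup>+z. ennreal (2 powr p) * (ennreal (d (h z) a powr p) + ennreal (d a (h s) powr p)) \<partial>\<nu>)"
    by (intro nn_integral_mono ennreal_metric_powr_triangle p) unfold_locales
  also have "\<dots> = ennreal (2 powr p) * ((\<integral>\<^sup>+z. ennreal (d a (h z) powr p) \<partial>\<nu>) + ennreal (d a (h s) powr p))"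
    by (simp add: nn_integral_cmult nn_integral_add emeasure_space_1 commute[of _ a])
  also have "(\<integral>\<^sup>+z. ennreal (d a (h z) powr p) \<partial>\<nu>) = ennreal A"
    using moment by (simp add: nn_integral_distr)
  finally show ?thesis
    using t \<open>A \<ge> 0\<close> by (simp add: ennreal_mult ennreal_plus mult_left_mono)
qed

text \<open>As \<open>f s\<close> is nonnegative, the new mass adds nothing to the negative part,
  which merely shrinks by the factor \<open>1 - t\<close> and stays finite. From the positive part
  only the contribution \<open>t * f s\<close> is kept.\<close>

lemma ext_integral_contaminate:
  fixes f :: "'s::second_countable_topology \<Rightarrow> real"
  assumes \<nu>: "\<nu> \<in> borel_probs" and t: "0 \<le> t" "t \<le> 1"
    and f [measurable]: "f \<in> borel_measurable borel"
    and s: "f s \<ge> 0"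
    and neg: "(\<integral>\<^sup>+z. ennreal (- f z) \<partial>\<nu>) = ennreal N" "N \<ge> 0"
  shows "integral_well_defined (contaminate \<nu> t s) f"
    and "ext_integral (contaminate \<nu> t s) f \<ge> ereal (t * f s - N)"
proof -
  have neg_part: "(\<integral>\<^sup>+z. ennreal (- f z) \<partial>contaminate \<nu> t s) = ennreal ((1 - t) * N)"
    using s neg t by (simp add: nn_integral_contaminate[OF \<nu> t] ennreal_neg ennreal_mult)
  then show "integral_well_defined (contaminate \<nu> t s) f"
    by (simp add: integral_well_defined_def)
  have "ennreal (t * f s) \<le> (\<integral>\<^sup>+z. ennreal (f z) \<partial>contaminate \<nu> t s)"
    using s t by (simp add: nn_integral_contaminate[OF \<nu> t] ennreal_mult)
  then have pos_part: "ereal (t * f s) \<le> enn2ereal (\<integral>\<^sup>+z. ennreal (f z) \<partial>contaminate \<nu> t s)"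
    using s t by (simp add: less_eq_ennreal.rep_eq enn2ereal_ennreal)
  have "(1 - t) * N \<le> N"
    using t neg(2) by (simp add: mult_left_le_one_le)
  then have "ereal (t * f s - N) \<le> ereal (t * f s) - ereal ((1 - t) * N)"
    by simp
  also have "\<dots> \<le> ext_integral (contaminate \<nu> t s) f"
    unfolding ext_integral_def neg_part using pos_part t neg(2)
    by (intro ereal_minus_mono) (auto simp: enn2ereal_ennreal)
  finally show "ext_integral (contaminate \<nu> t s) f \<ge> ereal (t * f s - N)" .
qed

text \<open>Each contaminated measure tests \<open>f\<close> at one point \<open>s\<close>. The
  constants \<open>r\<close>, \<open>N\<close> and \<open>\<epsilon>\<close> do not depend on
  \<open>s\<close>, so the resulting pointwise bounds share one \<open>M\<close>. The base points
  are arbitrary.\<close>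

lemma growth_if_robust_value_finite:
  fixes d1 :: "'y1::polish_space \<times> 'x::polish_space \<Rightarrow> 'y1 \<times> 'x \<Rightarrow> real"
    and d2 :: "'y2::polish_space \<times> 'x \<Rightarrow> 'y2 \<times> 'x \<Rightarrow> real"
  assumes d: "polish_metric d1" "polish_metric d2"
    and p: "p1 \<ge> 0" "p2 \<ge> 0"
    and \<mu>: "\<mu>13 \<in> borel_probs_moment d1 p1" "\<mu>23 \<in> borel_probs_moment d2 p2"
    and f: "f \<in> borel_measurable borel"
    and \<nu>0: "\<nu>0 \<in> overlapping_fiber \<mu>13 \<mu>23" "integral_well_defined \<nu>0 f" "ext_integral \<nu>0 f > -\<infinity>"
    and \<delta>: "\<And>i. \<delta> $ i > 0"
    and fin: "robust_value (\<lambda>s s'. d1 s s' powr p1) (\<lambda>s s'. d2 s s' powr p2) \<mu>13 \<mu>23 f \<delta> < \<infinity>"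
  shows "\<exists>M > 0. \<forall>s. f s \<le> M * (1 + d1 a1 (proj13 s) powr p1 + d2 a2 (proj23 s) powr p2)"
proof -
  let ?R = "robust_value (\<lambda>s s'. d1 s s' powr p1) (\<lambda>s s'. d2 s s' powr p2) \<mu>13 \<mu>23 f \<delta>"
  have \<nu>: "\<nu>0 \<in> borel_probs" and \<mu>13: "\<mu>13 = distr \<nu>0 borel proj13" and \<mu>23: "\<mu>23 = distr \<nu>0 borel proj23"
    using \<nu>0(1) by (auto simp: overlapping_fiber_def marginal13_def marginal23_def)
  \<comment> \<open>The bound is taken nonnegative, also when the supremum is negative or
    \<open>-\<infinity>\<close>, to make \<open>M\<close> positive below.\<close>
  obtain r where r: "?R \<le> ereal r" "r \<ge> 0"
  proof (cases ?R)
    case (real x)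
    then show ?thesis using that[of "max x 0"] by simp
  qed (use fin that[of 0] in auto)
  obtain A1 where A1: "(\<integral>\<^sup>+x. ennreal (d1 a1 x powr p1) \<partial>\<mu>13) = ennreal A1" "A1 \<ge> 0"
    using borel_probs_moment_finite[OF d(1) p(1) \<mu>(1), of a1]
    by (cases "\<integral>\<^sup>+x. ennreal (d1 a1 x powr p1) \<partial>\<mu>13") auto
  obtain A2 where A2: "(\<integral>\<^sup>+x. ennreal (d2 a2 x powr p2) \<partial>\<mu>23) = ennreal A2" "A2 \<ge> 0"
    using borel_probs_moment_finite[OF d(2) p(2) \<mu>(2), of a2]
    by (cases "\<integral>\<^sup>+x. ennreal (d2 a2 x powr p2) \<partial>\<mu>23") auto
  \<comment> \<open>Were the negative part of infinite integral, the positive part would be finite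
    and the integral over \<open>\<nu>0\<close> would equal \<open>-\<infinity>\<close>.\<close>
  obtain N where N: "(\<integral>\<^sup>+z. ennreal (- f z) \<partial>\<nu>0) = ennreal N" "N \<ge> 0"
  proof (cases "\<integral>\<^sup>+z. ennreal (- f z) \<partial>\<nu>0")
    case top
    with \<nu>0(2) have "(\<integral>\<^sup>+z. ennreal (f z) \<partial>\<nu>0) < \<infinity>"
      by (simp add: integral_well_defined_def)
    then obtain P where "(\<integral>\<^sup>+z. ennreal (f z) \<partial>\<nu>0) = ennreal P" "P \<ge> 0"
      by (cases "\<integral>\<^sup>+z. ennreal (f z) \<partial>\<nu>0") auto
    with top \<nu>0(3) show ?thesis
      by (simp add: ext_integral_def enn2ereal_ennreal)
  qed (use that in auto)
  define K1 where "K1 = 2 powr p1 * (A1 + 1)"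
  define K2 where "K2 = 2 powr p2 * (A2 + 1)"
  have K: "K1 > 0" "K2 > 0"
    using A1(2) A2(2) by (simp_all add: K1_def K2_def)
  \<comment> \<open>The bound 1 keeps the fraction \<open>t\<close> at most 1; the two quotients
    keep \<open>\<epsilon> * K1\<close> and \<open>\<epsilon> * K2\<close> within the
    budgets.\<close>
  define \<epsilon> where "\<epsilon> = min 1 (min (\<delta> $ 1 / K1) (\<delta> $ 2 / K2))"
  have \<epsilon>: "0 < \<epsilon>" "\<epsilon> \<le> 1"
    using K \<delta> by (simp_all add: \<epsilon>_def)
  have "\<epsilon> \<le> \<delta> $ 1 / K1" "\<epsilon> \<le> \<delta> $ 2 / K2"
    by (simp_all add: \<epsilon>_def)
  then have \<epsilon>K: "\<epsilon> * K1 \<le> \<delta> $ 1" "\<epsilon> * K2 \<le> \<delta> $ 2"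
    using K by (simp_all add: pos_le_divide_eq)
  \<comment> \<open>This comes from solving \<open>t * f s \<le> r + N\<close> for
    \<open>f s\<close>, with \<open>t\<close> the quotient of \<open>\<epsilon>\<close> by one plus
    the distance terms. The extra 1 makes \<open>M\<close> positive even if \<open>r\<close> and
    \<open>N\<close> vanish.\<close>
  define M where "M = (r + N + 1) / \<epsilon>"
  have M: "M > 0"
    using r(2) N(2) \<epsilon> by (simp add: M_def)
  have "f s \<le> M * (1 + d1 a1 (proj13 s) powr p1 + d2 a2 (proj23 s) powr p2)" for s
  proof (cases "f s \<ge> 0")
    case False
    have "0 \<le> M * (1 + d1 a1 (proj13 s) powr p1 + d2 a2 (proj23 s) powr p2)"
      using M by simp
    with False show ?thesis by linarith
  next
    case True
    define D1 where "D1 = d1 a1 (proj13 s) powr p1"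
    define D2 where "D2 = d2 a2 (proj23 s) powr p2"
    have D: "D1 \<ge> 0" "D2 \<ge> 0" by (simp_all add: D1_def D2_def)
    define t where "t = \<epsilon> / (1 + D1 + D2)"
    have t: "0 \<le> t" "t \<le> 1" "t * (1 + D1 + D2) = \<epsilon>"
      using \<epsilon> D by (simp_all add: t_def)
    \<comment> \<open>The factor \<open>1 + D1 + D2\<close> hidden in \<open>t\<close> absorbs
      either distance term, so a single \<open>t\<close> meets both budgets.\<close>
    have budget: "t * (2 powr p * (A + D)) \<le> \<epsilon> * (2 powr p * (A + 1))"
      if "A \<ge> 0" "0 \<le> D" "D \<le> D1 + D2" for p A D
    proof -
      have "A + D \<le> (A + 1) * (1 + D1 + D2)"
        using that mult_nonneg_nonneg[OF that(1) D(1)] mult_nonneg_nonneg[OF that(1) D(2)]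
        unfolding distrib_left distrib_right by linarith
      then have "t * (2 powr p * (A + D)) \<le> t * (2 powr p * ((A + 1) * (1 + D1 + D2)))"
        using t by (intro mult_left_mono) auto
      also have "\<dots> = (t * (1 + D1 + D2)) * (2 powr p * (A + 1))"
        by (simp only: mult_ac)
      finally show ?thesis by (simp only: t(3))
    qed
    have cost1: "t * (2 powr p1 * (A1 + D1)) \<le> \<delta> $ 1"
      using budget[of A1 D1 p1] A1(2) D \<epsilon>K(1) unfolding K1_def by linarith
    have cost2: "t * (2 powr p2 * (A2 + D2)) \<le> \<delta> $ 2"
      using budget[of A2 D2 p2] A2(2) D \<epsilon>K(2) unfolding K2_def by linarith
    let ?\<gamma> = "contaminate \<nu>0 t s"
    have "transport_cost (\<lambda>s s'. d1 s s' powr p1) \<mu>13 (marginal13 ?\<gamma>) \<le> ennreal (\<delta> $ 1)"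
      unfolding \<mu>13 marginal13_def
      using A1 cost1
      by (intro order_trans[OF transport_cost_contaminate_le[OF \<nu> t(1,2) _ d(1) p(1)]] ennreal_leI)
        (auto simp: \<mu>13 D1_def)
    moreover have "transport_cost (\<lambda>s s'. d2 s s' powr p2) \<mu>23 (marginal23 ?\<gamma>) \<le> ennreal (\<delta> $ 2)"
      unfolding \<mu>23 marginal23_def
      using A2 cost2
      by (intro order_trans[OF transport_cost_contaminate_le[OF \<nu> t(1,2) _ d(2) p(2)]] ennreal_leI)
        (auto simp: \<mu>23 D2_def)
    ultimately have "?\<gamma> \<in> ambiguity_set (\<lambda>s s'. d1 s s' powr p1) (\<lambda>s s'. d2 s s' powr p2) \<mu>13 \<mu>23 \<delta>"
      by (simp add: ambiguity_set_def contaminate_in_borel_probs[OF \<nu> t(1,2)])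
    then have "ext_integral ?\<gamma> f \<le> ?R"
      unfolding robust_value_def
      using ext_integral_contaminate(1)[OF \<nu> t(1,2) f True N] by (intro SUP_upper) auto
    with ext_integral_contaminate(2)[OF \<nu> t(1,2) f True N] r(1)
    have "ereal (t * f s - N) \<le> ereal r"
      by (meson order_trans)
    \<comment> \<open>The 1 is added only to match the numerator of \<open>M\<close>.\<close>
    then have "t * f s \<le> r + N + 1"
      by simp
    then have "\<epsilon> * f s \<le> (r + N + 1) * (1 + D1 + D2)"
      using D by (simp add: t_def field_simps)
    then have "f s \<le> M * (1 + D1 + D2)"
      using \<epsilon> by (simp add: M_def field_simps)
    then show ?thesis by (simp add: D1_def D2_def)
  qed
  with M show ?thesis by blast
qed

section \<open>Equivalence of finite value and growth\<close>

theorem theorem4p2: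
  fixes d1 :: "'y1::polish_space \<times> 'x::polish_space \<Rightarrow> 'y1 \<times> 'x \<Rightarrow> real"
    and d2 :: "'y2::polish_space \<times> 'x \<Rightarrow> 'y2 \<times> 'x \<Rightarrow> real"
    and p1 p2 :: real
    and \<mu>13 :: "('y1 \<times> 'x) measure"
    and \<mu>23 :: "('y2 \<times> 'x) measure"
    and f :: "'y1 \<times> 'y2 \<times> 'x \<Rightarrow> real"
  assumes "polish_metric d1" and "polish_metric d2"
    and "p1 \<ge> 1" and "p2 \<ge> 1"
    and "\<mu>13 \<in> borel_probs_moment d1 p1" and "\<mu>23 \<in> borel_probs_moment d2 p2"
    and "distr \<mu>13 borel snd = distr \<mu>23 borel snd"
    and "f \<in> borel_measurable borel"
    and "\<exists>\<nu>0 \<in> overlapping_fiber \<mu>13 \<mu>23. integral_well_defined \<nu>0 f \<and> ext_integral \<nu>0 f > -\<infinity>"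
  shows "\<forall>\<delta> :: real ^ 2. (\<forall>i. \<delta> $ i > 0) \<longrightarrow>
    (robust_value (\<lambda>s s'. d1 s s' powr p1) (\<lambda>s s'. d2 s s' powr p2) \<mu>13 \<mu>23 f \<delta> < \<infinity>
      \<longleftrightarrow>
     (\<exists>y1_star y2_star x_star. \<exists>M > 0. \<forall>y1 y2 x.
        f (y1, y2, x) \<le> M * (1 + d1 (y1_star, x_star) (y1, x) powr p1
                               + d2 (y2_star, x_star) (y2, x) powr p2)))"
proof (intro allI impI iffI)
  fix \<delta> :: "real ^ 2"
  let ?R = "robust_value (\<lambda>s s'. d1 s s' powr p1) (\<lambda>s s'. d2 s s' powr p2) \<mu>13 \<mu>23 f \<delta>"
  assume \<delta>: "\<forall>i. \<delta> $ i > 0"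
  have p: "p1 \<ge> 0" "p2 \<ge> 0" using assms(3,4) by auto
  {
    \<comment> \<open>Growth is derived around every base point with a common coordinate
      \<open>x\<close>; any one of them then serves as witness.\<close>
    fix y1 y2 x
    assume R: "?R < \<infinity>"
    from assms(9) obtain \<nu>0 where \<nu>0: "\<nu>0 \<in> overlapping_fiber \<mu>13 \<mu>23"
        "integral_well_defined \<nu>0 f" "ext_integral \<nu>0 f > -\<infinity>"
      by blast
    have "\<exists>M > 0. \<forall>s. f s \<le>
        M * (1 + d1 (y1, x) (proj13 s) powr p1 + d2 (y2, x) (proj23 s) powr p2)"
      by (rule growth_if_robust_value_finite[OF assms(1,2) p assms(5,6,8) \<nu>0 _ R]) (use \<delta> in auto)
    then have "\<exists>M > 0. \<forall>y1' y2' x'. f (y1', y2', x')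
        \<le> M * (1 + d1 (y1, x) (y1', x') powr p1 + d2 (y2, x) (y2', x') powr p2)"
      by (force simp: proj13_def proj23_def)
  }
  then show "\<exists>y1_star y2_star x_star. \<exists>M > 0. \<forall>y1 y2 x.
      f (y1, y2, x) \<le> M * (1 + d1 (y1_star, x_star) (y1, x) powr p1
                             + d2 (y2_star, x_star) (y2, x) powr p2)"
    if "?R < \<infinity>"
    using that by blast
  show "?R < \<infinity>"
    if "\<exists>y1_star y2_star x_star. \<exists>M > 0. \<forall>y1 y2 x.
      f (y1, y2, x) \<le> M * (1 + d1 (y1_star, x_star) (y1, x) powr p1
                             + d2 (y2_star, x_star) (y2, x) powr p2)"
  proof -
    from that obtain y1 y2 x M where M: "M > 0" and growth: "\<And>y1' y2' x'. f (y1', y2', x')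
        \<le> M * (1 + d1 (y1, x) (y1', x') powr p1 + d2 (y2, x) (y2', x') powr p2)"
      by blast
    show ?thesis
    proof (rule robust_value_finite_if_growth[OF assms(1,2) p assms(5,6)])
      show "f s \<le> M * (1 + d1 (y1, x) (proj13 s) powr p1 + d2 (y2, x) (proj23 s) powr p2)" for s
        using growth by (cases s) (simp add: proj13_def proj23_def)
    qed (use M \<delta> in \<open>auto intro: less_imp_le\<close>)
  qed
qed

end
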